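(* Let $t \geq 2$ be an integer. If $G$ is a graph with $n$ vertices, minimum degree $d$, and no induced subgraph isomorphic to $K_{2,t+1}$, then \[ \omega (G) \geq \left( \frac{d^2}{2nt} \left( 1 - o(1) \right) \right)^{1/t} - t, \] where $o(1)$ denotes a quantity tending to $0$ as $n \to \infty$.
   Context: $\omega(G)$ is the clique number of $G$, the maximum order of a clique (set of pairwise adjacent vertices) in $G$. *)

theory Defs
  imports Complex_Main "Graph_Theory.Graph_Theory"
begin

text \<open>
  A finite simple graph is a digraph \<open>G\<close> with \<open>graph G\<close>: finite, loop-free, without
  parallel arcs, and symmetric, so that each undirected edge \<open>uv\<close> is the pair of arcs from \<open>u\<close> to
  \<open>v\<close> and from \<open>v\<close> to \<open>u\<close>. The degree of a vertex is therefore its out-degree.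
\<close>

definition min_degree :: "('a, 'b) pre_digraph \<Rightarrow> nat" where
  "min_degree G = Min (out_degree G ` verts G)"

definition clique :: "('a, 'b) pre_digraph \<Rightarrow> 'a set \<Rightarrow> bool" where
  "clique G S \<longleftrightarrow> S \<subseteq> verts G \<and> (\<forall>u\<in>S. \<forall>v\<in>S. u \<noteq> v \<longrightarrow> u \<rightarrow>\<^bsub>G\<^esub> v)"

definition clique_number :: "('a, 'b) pre_digraph \<Rightarrow> nat" where
  "clique_number G = Max {card S | S. clique G S}"

text \<open>
  No induced subgraph of \<open>G\<close> is isomorphic to the graph \<open>K\<^bsub>m,n\<^esub>\<close>; the library predicate
  \<open>complete_bipartite_digraph m n\<close> holds of exactly the isomorphic copies.
\<close>

definition induced_biclique_free :: "nat \<Rightarrow> nat \<Rightarrow> ('a, 'b) pre_digraph \<Rightarrow> bool" where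
  "induced_biclique_free m n G \<longleftrightarrow>
     \<not> (\<exists>H. induced_subgraph H G \<and> complete_bipartite_digraph m n H)"

end

theory Submission
  imports Defs
begin

text \<open>
  Suppose that \<open>(\<omega> + t) ^ t < d\<^sup>2 / (2 * n * t)\<close>. The common neighbourhood of two non-adjacent
  vertices contains no independent set of size \<open>t + 1\<close>, so by Ramsey's theorem it has fewer than
  \<open>M = (\<omega> + t) choose t\<close> vertices, and \<open>4 * n * M < d\<^sup>2\<close>. Take an independent set of maximum
  size \<open>\<alpha>\<close>. Bonferroni's inequality, applied to the neighbourhoods of an independent set of size
  about \<open>4 * n / (3 * d)\<close>, shows that \<open>\<alpha> \<le> 4 * n / (3 * d)\<close>. On the other hand, the vertices that
  have at most one neighbour in the maximum independent set split into \<open>\<alpha>\<close> cliques, whence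
  \<open>n \<le> \<alpha> * \<omega> + (\<alpha> choose 2) * M\<close>. So \<open>\<omega>\<close> is at least of order \<open>d\<close>, and
  \<open>(\<omega> + t) ^ t \<ge> \<omega>\<^sup>2\<close> is too large. The argument needs no error term: \<open>\<epsilon> = 0\<close> works.
\<close>

section \<open>Ramsey and Bonferroni bounds for finite sets\<close>

text \<open>The Erdos-Szekeres induction: around a fixed \<open>v\<close>, cliques among its
  neighbours and independent sets among its non-neighbours can be extended by \<open>v\<close>, so
  one parameter drops in each class. Pascal's rule adds the two bounds, and since both are strict,
  there is room for \<open>v\<close> itself.\<close>

lemma card_less_Ramsey_binomial:
  fixes E :: "('a \<times> 'a) set"
  assumes "finite C" "sym E"
    and "\<And>K. K \<subseteq> C \<Longrightarrow> pairwise (\<lambda>u v. (u, v) \<in> E) K \<Longrightarrow> card K \<le> w"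
    and "\<And>I. I \<subseteq> C \<Longrightarrow> pairwise (\<lambda>u v. (u, v) \<notin> E) I \<Longrightarrow> card I \<le> t"
  shows "card C < (w + t) choose t"
  using assms
proof (induction "w + t" arbitrary: w t C rule: less_induct)
  case less
  show ?case
  proof (cases "C = {}")
    case True
    then show ?thesis by simp
  next
    case False
    then obtain v where v: "v \<in> C" by auto
    \<comment> \<open>A singleton is both a clique and independent, so both parameters are positive
      and have predecessors.\<close>
    have "card {v} \<le> w" "card {v} \<le> t"
      using less.prems(3)[of "{v}"] less.prems(4)[of "{v}"] v by (auto simp: pairwise_def)
    then obtain w' t' where wt: "w = Suc w'" "t = Suc t'"
      by (metis One_nat_def Suc_le_D is_singletonI is_singleton_altdef)
    have commute: "(x, y) \<in> E \<longleftrightarrow> (y, x) \<in> E" for x y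
      using \<open>sym E\<close> by (auto elim: symE)
    define A where "A = {u \<in> C - {v}. (v, u) \<in> E}"
    define B where "B = {u \<in> C - {v}. (v, u) \<notin> E}"
    have fin: "finite A" "finite B" "A \<inter> B = {}" and C: "C = insert v (A \<union> B)" "v \<notin> A \<union> B"
      using less.prems(1) v by (auto simp: A_def B_def)
    have "card A < (w' + t) choose t"
    proof (rule less.hyps)
      fix K assume K: "K \<subseteq> A" "pairwise (\<lambda>u v. (u, v) \<in> E) K"
      have "pairwise (\<lambda>u v. (u, v) \<in> E) (insert v K)"
        using K commute by (auto simp: pairwise_insert A_def)
      then have "card (insert v K) \<le> w"
        using less.prems(3)[of "insert v K"] K C by auto
      moreover have "finite K" "v \<notin> K" using K fin C finite_subset by auto
      ultimately show "card K \<le> w'" using wt by simp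
    next
      fix I assume "I \<subseteq> A" "pairwise (\<lambda>u v. (u, v) \<notin> E) I"
      then show "card I \<le> t" using less.prems(4)[of I] C by auto
    qed (use wt fin \<open>sym E\<close> in auto)
    moreover have "card B < (w + t') choose t'"
    proof (rule less.hyps)
      fix I assume I: "I \<subseteq> B" "pairwise (\<lambda>u v. (u, v) \<notin> E) I"
      have "pairwise (\<lambda>u v. (u, v) \<notin> E) (insert v I)"
        using I commute by (auto simp: pairwise_insert B_def)
      then have "card (insert v I) \<le> t"
        using less.prems(4)[of "insert v I"] I C by auto
      moreover have "finite I" "v \<notin> I" using I fin C finite_subset by auto
      ultimately show "card I \<le> t'" using wt by simp
    next
      fix K assume "K \<subseteq> B" "pairwise (\<lambda>u v. (u, v) \<in> E) K"
      then show "card K \<le> w" using less.prems(3)[of K] C by auto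
    qed (use wt fin \<open>sym E\<close> in auto)
    moreover have "card C = Suc (card A + card B)"
      using C fin by (simp add: card_Un_disjoint)
    ultimately show ?thesis using wt by simp
  qed
qed

text \<open>Adding \<open>N a\<close> to the union of the other sets loses only its overlap with
  that union, at most \<open>card S * M\<close>; the binomial coefficient grows by exactly
  \<open>card S\<close>.\<close>

lemma sum_card_le_card_UN:
  assumes "finite S" "\<And>x. x \<in> S \<Longrightarrow> finite (N x)"
    and "\<And>x y. x \<in> S \<Longrightarrow> y \<in> S \<Longrightarrow> x \<noteq> y \<Longrightarrow> card (N x \<inter> N y) \<le> M"
  shows "(\<Sum>x\<in>S. card (N x)) \<le> card (\<Union>x\<in>S. N x) + (card S choose 2) * M"
  using assms
proof (induction S rule: finite_induct)
  case empty
  then show ?case by simp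
next
  case (insert a S)
  let ?U = "\<Union>x\<in>S. N x"
  have fin: "finite (N a)" "finite ?U" using insert by auto
  have "card (N a \<inter> ?U) = card (\<Union>x\<in>S. N a \<inter> N x)"
    by (rule arg_cong[of _ _ card]) auto
  also have "\<dots> \<le> (\<Sum>x\<in>S. card (N a \<inter> N x))" using insert by (intro card_UN_le) auto
  also have "\<dots> \<le> (\<Sum>x\<in>S. M)" using insert by (intro sum_mono) auto
  finally have "card (N a \<inter> ?U) \<le> card S * M" by simp
  moreover have "card (N a) + card ?U = card (N a \<union> ?U) + card (N a \<inter> ?U)"
    using fin by (rule card_Un_Int)
  moreover have "(\<Sum>x\<in>S. card (N x)) \<le> card ?U + (card S choose 2) * M"
    using insert by auto
  moreover have "Suc (card S) choose 2 = card S + (card S choose 2)"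
    by (simp add: numeral_2_eq_2)
  ultimately show ?case using insert by (simp add: algebra_simps)
qed

section \<open>Neighbourhoods, cliques and independent sets of a simple graph\<close>

context graph
begin

abbreviation "indep S \<equiv> S \<subseteq> verts G \<and> pairwise (\<lambda>u v. (u, v) \<notin> arcs_ends G) S"

lemma sym_arcs_ends: "sym (arcs_ends G)"
  using sym_arcs by (simp add: symmetric_def)

lemma arcs_ends_commute: "(u, v) \<in> arcs_ends G \<longleftrightarrow> (v, u) \<in> arcs_ends G"
  using sym_arcs_ends by (auto elim: symE)

lemma finite_arcs_ends_Image: "finite (arcs_ends G `` X)"
  by (rule finite_subset[OF _ finite_verts]) (auto dest: adj_in_verts)

lemma out_degree_eq_card_Image: "out_degree G v = card (arcs_ends G `` {v})"
proof -
  have "arcs_ends G `` {v} = head G ` out_arcs G v"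
    by (auto simp: arcs_ends_conv image_iff)
  moreover have "inj_on (head G) (out_arcs G v)"
    using no_multi_arcs by (auto simp: inj_on_def arc_to_ends_def)
  ultimately show ?thesis by (simp add: out_degree_def card_image)
qed

lemma card_clique_le:
  assumes "clique G K"
  shows "card K \<le> clique_number G"
  unfolding clique_number_def
proof (rule Max_ge)
  have "{card S |S. clique G S} \<subseteq> card ` Pow (verts G)"
    by (auto simp: clique_def)
  then show "finite {card S |S. clique G S}"
    using finite_verts by (meson finite_Pow_iff finite_imageI finite_subset)
qed (use assms in blast)

text \<open>Any \<open>t + 1\<close> independent common neighbours would span, together with
  \<open>x\<close> and \<open>y\<close>, an induced \<open>K_{2,t+1}\<close>. Hence the Ramsey bound
  applies to the common neighbourhood.\<close>

lemma card_common_neighbours_less: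
  assumes free: "induced_biclique_free 2 (t + 1) G"
    and xy: "x \<in> verts G" "y \<in> verts G" "x \<noteq> y" "(x, y) \<notin> arcs_ends G"
  shows "card (arcs_ends G `` {x} \<inter> arcs_ends G `` {y}) < (clique_number G + t) choose t"
proof (rule card_less_Ramsey_binomial)
  let ?C = "arcs_ends G `` {x} \<inter> arcs_ends G `` {y}"
  show "finite ?C" using finite_arcs_ends_Image by blast
  show "sym (arcs_ends G)" by (rule sym_arcs_ends)
  fix K assume "K \<subseteq> ?C" "pairwise (\<lambda>u v. (u, v) \<in> arcs_ends G) K"
  then have "clique G K" by (auto simp: clique_def pairwise_def dest: adj_in_verts)
  then show "card K \<le> clique_number G" by (rule card_clique_le)
next
  let ?C = "arcs_ends G `` {x} \<inter> arcs_ends G `` {y}"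
  fix I assume I: "I \<subseteq> ?C" "pairwise (\<lambda>u v. (u, v) \<notin> arcs_ends G) I"
  show "card I \<le> t"
  proof (rule ccontr)
    assume "\<not> card I \<le> t"
    then obtain J where J: "J \<subseteq> I" "card J = t + 1"
      by (metis Suc_eq_plus1 not_less_eq_eq obtain_subset_with_card_n)
    let ?H = "G \<restriction> ({x, y} \<union> J)"
    have sub: "{x, y} \<union> J \<subseteq> verts G" using xy J I by (auto dest: adj_in_verts)
    have ind: "induced_subgraph ?H G" by (rule induced_induce[OF sub])
    have ends: "arcs_ends ?H = {(u, v) \<in> arcs_ends G. u \<in> {x, y} \<union> J \<and> v \<in> {x, y} \<union> J}"
      by (auto simp: arcs_ends_conv image_iff)
    have adj: "(x, v) \<in> arcs_ends G \<and> (y, v) \<in> arcs_ends G \<and>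
      (v, x) \<in> arcs_ends G \<and> (v, y) \<in> arcs_ends G" if "v \<in> J" for v
      using that J I arcs_ends_commute by auto
    \<comment> \<open>\<open>pairwise\<close> speaks of distinct vertices only; the case
      \<open>u = v\<close> needs that there are no loops.\<close>
    have nadj: "(u, v) \<notin> arcs_ends G" if "u \<in> J" "v \<in> J" for u v
      proof -
      have "u \<in> I" "v \<in> I" using that J by auto
      then show ?thesis using I(2) adj_not_same by (cases "u = v") (auto simp: pairwise_def)
    qed
    have nxy: "(u, v) \<notin> arcs_ends G" if "u \<in> {x, y}" "v \<in> {x, y}" for u v
      using that xy adj_not_same arcs_ends_commute by auto
    have "arcs_ends ?H = {x, y} \<times> J \<union> J \<times> {x, y}"
      unfolding ends using adj nadj nxy by blast
    moreover have "{x, y} \<inter> J = {}" using adj adj_not_same by blast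
    moreover have "graph ?H"
    proof -
      have "digraph ?H" using ind by (rule digraphI_induced)
      moreover have "symmetric ?H" using sym_arcs ind by (rule induced_graph_imp_symmetric)
      ultimately show ?thesis by (rule digraph.graphI)
    qed
    moreover have "verts ?H = {x, y} \<union> J" "card {x, y} = 2" using xy by simp_all
    ultimately have "complete_bipartite_digraph 2 (t + 1) ?H"
      unfolding complete_bipartite_digraph_def using J(2) by blast
    with ind free show False by (auto simp: induced_biclique_free_def)
  qed
qed

text \<open>The neighbourhoods of the vertices in \<open>S\<close> each have at least
  \<open>d\<close> elements, lie in the vertex set and overlap pairwise in at most \<open>M\<close>
  vertices, so Bonferroni's inequality applies.\<close>

lemma indep_mult_degree_le:
  assumes "indep S" "\<And>v. v \<in> verts G \<Longrightarrow> d \<le> out_degree G v"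
    and "\<And>x y. x \<in> S \<Longrightarrow> y \<in> S \<Longrightarrow> x \<noteq> y \<Longrightarrow>
      card (arcs_ends G `` {x} \<inter> arcs_ends G `` {y}) \<le> M"
  shows "card S * d \<le> card (verts G) + (card S choose 2) * M"
proof -
  have "finite S" using assms(1) finite_subset finite_verts by blast
  have "card S * d = (\<Sum>x\<in>S. d)" by simp
  also have "\<dots> \<le> (\<Sum>x\<in>S. card (arcs_ends G `` {x}))"
    using assms by (intro sum_mono) (auto simp: out_degree_eq_card_Image)
  also have "\<dots> \<le> card (\<Union>x\<in>S. arcs_ends G `` {x}) + (card S choose 2) * M"
    using assms \<open>finite S\<close> finite_arcs_ends_Image by (intro sum_card_le_card_UN) auto
  also have "card (\<Union>x\<in>S. arcs_ends G `` {x}) \<le> card (verts G)"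
    by (intro card_mono) (auto dest: adj_in_verts)
  finally show ?thesis by simp
qed

lemma card_verts_le_of_max_indep:
  assumes S: "indep S" and max: "\<And>T. indep T \<Longrightarrow> card T \<le> card S"
    and M: "\<And>x y. x \<in> S \<Longrightarrow> y \<in> S \<Longrightarrow> x \<noteq> y \<Longrightarrow>
      card (arcs_ends G `` {x} \<inter> arcs_ends G `` {y}) \<le> M"
  shows "card (verts G) \<le> card S * clique_number G + (card S choose 2) * M"
proof -
  let ?E = "arcs_ends G"
  have "finite S" using S finite_subset finite_verts by blast
  \<comment> \<open>\<open>B x\<close> consists of \<open>x\<close> and the outside vertices whose
    only neighbour in \<open>S\<close> is \<open>x\<close>. Vertices with two neighbours in
    \<open>S\<close> fall into \<open>D p\<close> for some pair \<open>p\<close>.\<close>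
  define B where "B x = {v \<in> verts G. v = x \<or> v \<notin> S \<and> (\<forall>y\<in>S. (v, y) \<in> ?E \<longleftrightarrow> y = x)}" for x
  define P where "P = {p. p \<subseteq> S \<and> card p = 2}"
  define D where "D p = (\<Inter>x\<in>p. ?E `` {x})" for p
  have B: "card (B x) \<le> clique_number G" if x: "x \<in> S" for x
  proof (rule card_clique_le)
    show "clique G (B x)"
      unfolding clique_def
    proof (intro conjI ballI impI)
      show "B x \<subseteq> verts G" by (auto simp: B_def)
      fix u v assume uv: "u \<in> B x" "v \<in> B x" "u \<noteq> v"
      show "(u, v) \<in> ?E"
      proof (rule ccontr)
        assume nE: "(u, v) \<notin> ?E"
        have "u \<noteq> x" "v \<noteq> x"
          using uv nE x arcs_ends_commute by (auto simp: B_def)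
        then have out: "u \<notin> S" "v \<notin> S" using uv by (auto simp: B_def)
        \<comment> \<open>exchanging \<open>x\<close> for \<open>u\<close> and \<open>v\<close> would give a larger independent set\<close>
        let ?T = "insert u (insert v (S - {x}))"
        have "indep ?T"
          using S uv nE arcs_ends_commute \<open>u \<noteq> x\<close> \<open>v \<noteq> x\<close>
          by (auto simp: pairwise_def B_def)
        then have "card ?T \<le> card S" by (rule max)
        moreover have "card S = Suc (card (S - {x}))"
          using \<open>finite S\<close> x by (rule card.remove)
        moreover have "card ?T = Suc (Suc (card (S - {x})))"
          using out uv(3) \<open>finite S\<close> by simp
        ultimately show False by simp
      qed
    qed
  qed
  have D: "card (D p) \<le> M" if "p \<in> P" for p
  proof -
    from that obtain x y where "p = {x, y}" "x \<noteq> y" "x \<in> S" "y \<in> S"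
      by (auto simp: P_def card_2_iff)
    then show ?thesis using M by (simp add: D_def)
  qed
  have "finite P" unfolding P_def using \<open>finite S\<close> by auto
  have "verts G \<subseteq> (\<Union>x\<in>S. B x) \<union> (\<Union>p\<in>P. D p)"
  proof
    fix v assume v: "v \<in> verts G"
    show "v \<in> (\<Union>x\<in>S. B x) \<union> (\<Union>p\<in>P. D p)"
    proof (cases "v \<in> S")
      case True
      then show ?thesis using v by (auto simp: B_def)
    next
      case False
      \<comment> \<open>Otherwise \<open>v\<close> could be added to \<open>S\<close>, against
        maximality.\<close>
      have "\<exists>x\<in>S. (v, x) \<in> ?E"
      proof (rule ccontr)
        assume "\<not> (\<exists>x\<in>S. (v, x) \<in> ?E)"
        then have "indep (insert v S)"
          using S v arcs_ends_commute by (auto simp: pairwise_insert)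
        then have "card (insert v S) \<le> card S" by (rule max)
        then show False using False \<open>finite S\<close> by simp
      qed
      then obtain x where x: "x \<in> S" "(v, x) \<in> ?E" by blast
      show ?thesis
      proof (cases "v \<in> B x")
        case True
        then show ?thesis using x by blast
      next
        case False
        then obtain y where y: "y \<in> S" "(v, y) \<in> ?E" "y \<noteq> x"
          using x v \<open>v \<notin> S\<close> by (auto simp: B_def)
        then have "{x, y} \<in> P" "v \<in> D {x, y}"
          using x arcs_ends_commute by (auto simp: P_def D_def)
        then show ?thesis by blast
      qed
    qed
  qed
  moreover have "finite ((\<Union>x\<in>S. B x) \<union> (\<Union>p\<in>P. D p))"
  proof -
    \<comment> \<open>An empty intersection would be the whole type; a member of \<open>p\<close>
      confines \<open>D p\<close> to a single finite neighbourhood.\<close>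
    have "finite (D p)" if "p \<in> P" for p
    proof -
      from that obtain x where "x \<in> p" by (force simp: P_def)
      then have "D p \<subseteq> ?E `` {x}" by (auto simp: D_def)
      then show ?thesis using finite_arcs_ends_Image finite_subset by blast
    qed
    then show ?thesis using \<open>finite S\<close> \<open>finite P\<close> by (auto simp: B_def)
  qed
  ultimately have "card (verts G) \<le> card ((\<Union>x\<in>S. B x) \<union> (\<Union>p\<in>P. D p))"
    by (intro card_mono)
  also have "\<dots> \<le> card (\<Union>x\<in>S. B x) + card (\<Union>p\<in>P. D p)" by (rule card_Un_le)
  also have "\<dots> \<le> (\<Sum>x\<in>S. card (B x)) + (\<Sum>p\<in>P. card (D p))"
    using \<open>finite S\<close> \<open>finite P\<close> by (intro add_mono card_UN_le)
  also have "\<dots> \<le> (\<Sum>x\<in>S. clique_number G) + (\<Sum>p\<in>P. M)"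
    using B D by (intro add_mono sum_mono)
  also have "\<dots> = card S * clique_number G + (card S choose 2) * M"
    using n_subsets[OF \<open>finite S\<close>, of 2] by (simp add: P_def)
  finally show ?thesis .
qed

section \<open>The numerical contradiction\<close>

theorem degree_square_le_clique_number_power:
  assumes t: "t \<ge> 2" and ne: "verts G \<noteq> {}"
    and free: "induced_biclique_free 2 (t + 1) G"
    and deg: "\<And>v. v \<in> verts G \<Longrightarrow> d \<le> out_degree G v"
  shows "(real d)\<^sup>2 \<le> 4 * real (card (verts G)) * real (clique_number G + t) ^ t"
proof (rule ccontr)
  define n w M where "n = card (verts G)" and "w = clique_number G" and "M = (w + t) choose t"
  assume "\<not> ?thesis"
  then have less: "4 * real n * real (w + t) ^ t < (real d)\<^sup>2"
    by (simp add: n_def w_def)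
  have "M \<le> (w + t) ^ t" unfolding M_def by (rule binomial_le_pow) simp
  then have "real M \<le> real (w + t) ^ t" by (metis of_nat_le_iff of_nat_power)
  then have "4 * real n * real M \<le> 4 * real n * real (w + t) ^ t" by (intro mult_left_mono) auto
  with less have nM: "4 * real n * real M < (real d)\<^sup>2" by linarith
  have n: "real n \<ge> 1" using ne by (simp add: n_def Suc_le_eq card_gt_0_iff)
  have d: "real d > 0"
  proof (rule ccontr)
    assume "\<not> real d > 0"
    then show False using nM by (simp add: mult_less_0_iff)
  qed
  have M: "card (arcs_ends G `` {x} \<inter> arcs_ends G `` {y}) \<le> M"
    if "indep S" "x \<in> S" "y \<in> S" "x \<noteq> y" for S x y
    using card_common_neighbours_less[OF free, of x y] that
    unfolding pairwise_def M_def w_def by (meson less_imp_le subsetD)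
  have choose2: "real (k choose 2) = real k * (real k - 1) / 2" for k
    by (cases k) (auto simp: choose_two real_of_nat_div field_simps)
  have "finite {S. indep S}"
    by (rule finite_subset[of _ "Pow (verts G)"]) auto
  then have fin: "finite (card ` {S. indep S})" by simp
  have "indep {}" by simp
  then have "Max (card ` {S. indep S}) \<in> card ` {S. indep S}"
    using fin by (intro Max_in) blast+
  then obtain S where S: "indep S" and "card S = Max (card ` {S. indep S})" by auto
  then have max: "card T \<le> card S" if "indep T" for T using fin that by auto
  define a where "a = real (card S)"
  obtain v where "v \<in> verts G" using ne by blast
  then have "card {v} \<le> card S" by (intro max) auto
  then have a1: "a \<ge> 1" by (simp add: a_def)
  \<comment> \<open>This is \<open>nM\<close> divided by \<open>3 * d\<close>. It bounds every
    overlap term below.\<close>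
  have Md: "4 * n / (3 * d) * M \<le> d / 3"
    using nM d by (simp add: field_simps power2_eq_square)
  have a: "a \<le> 4 * n / (3 * d)"
  proof (rule ccontr)
    assume less_a: "\<not> a \<le> 4 * n / (3 * d)"
    \<comment> \<open>The least integer above \<open>4 * n / (3 * d)\<close>. The overlaps then cost
      at most \<open>k * d / 6\<close>, so \<open>5 * k * d / 6 \<le> n\<close>, whereas
      \<open>k * d > 4 * n / 3\<close> makes the left side exceed \<open>10 * n / 9\<close>.\<close>
    define k where "k = Suc (nat \<lfloor>4 * real n / (3 * real d)\<rfloor>)"
    have k: "real k > 4 * n / (3 * d)" "real k - 1 \<le> 4 * n / (3 * d)"
      unfolding k_def by (auto simp: nat_add_distrib) linarith+
    with less_a have "real k < real (card S) + 1" unfolding a_def by linarith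
    then have "k \<le> card S" by linarith
    then obtain T where "T \<subseteq> S" "card T = k" by (rule obtain_subset_with_card_n)
    with S have T: "indep T" by (auto intro: pairwise_subset)
    have "card T * d \<le> n + (card T choose 2) * M"
      unfolding n_def using T by (intro indep_mult_degree_le[OF T] deg M) auto
    then have "real (k * d) \<le> real (n + (k choose 2) * M)"
      unfolding \<open>card T = k\<close> of_nat_le_iff .
    then have 1: "real k * d \<le> n + real k * ((real k - 1) * M) / 2"
      by (simp add: choose2 algebra_simps)
    have "(real k - 1) * M \<le> 4 * n / (3 * d) * M"
      using k by (intro mult_right_mono) auto
    also note Md
    finally have "real k * ((real k - 1) * M) \<le> real k * (d / 3)"
      by (intro mult_left_mono) auto
    with 1 have "real k * d \<le> n + real k * d / 6" by simp
    moreover have "real k * d > 4 * n / 3" using k d by (simp add: field_simps)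
    ultimately show False using n by linarith
  qed
  have "n \<le> card S * w + (card S choose 2) * M"
    unfolding n_def w_def by (intro card_verts_le_of_max_indep S max M[OF S])
  then have "real n \<le> real (card S * w + (card S choose 2) * M)" by (rule of_nat_mono)
  then have "real n \<le> a * w + a * ((a - 1) * M) / 2"
    by (simp add: choose2 a_def algebra_simps)
  moreover have "(a - 1) * M \<le> 4 * n / (3 * d) * M"
    using a by (intro mult_right_mono) auto
  then have "(a - 1) * M \<le> d / 3" using Md by linarith
  then have "a * ((a - 1) * M) \<le> a * (d / 3)" using a1 by (intro mult_left_mono) auto
  \<comment> \<open>The upper bound on \<open>a\<close>, read as a lower bound on \<open>n\<close>.
    Against \<open>n \<le> a * w + a * d / 6\<close> it leaves
    \<open>3/4 - 1/6 = 7/12\<close>.\<close>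
  moreover have "3 * a * d / 4 \<le> n" using a d by (simp add: field_simps)
  ultimately have "a * (7 * d / 12) \<le> a * w" by (simp add: field_simps)
  then have w: "7 * d / 12 \<le> real w" using a1 by simp
  have "(7 * d / 12)\<^sup>2 \<le> (real w)\<^sup>2" using w by (intro power_mono) auto
  also have "\<dots> \<le> (real (w + t))\<^sup>2" by (intro power_mono) auto
  also have "\<dots> \<le> real (w + t) ^ t" using t by (intro power_increasing) auto
  \<comment> \<open>Since \<open>4 * 49 / 144 > 1\<close> and \<open>n \<ge> 1\<close>, this
    contradicts \<open>less\<close>.\<close>
  finally have "49 / 144 * (real d)\<^sup>2 \<le> real (w + t) ^ t"
    by (simp add: power_divide power_mult_distrib)
  moreover have "1 * real (w + t) ^ t \<le> real n * real (w + t) ^ t"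
    using n by (intro mult_right_mono) auto
  moreover have "(real d)\<^sup>2 > 0" using d by simp
  ultimately show False using less by linarith
qed

end

theorem theorem3:
  fixes t :: nat
  assumes "t \<ge> 2"
  shows "\<exists>\<epsilon> :: nat \<Rightarrow> real. \<epsilon> \<longlonglongrightarrow> 0 \<and>
    (\<forall>(G :: ('a, 'b) pre_digraph) n d.
       graph G \<and> verts G \<noteq> {} \<and> card (verts G) = n \<and> min_degree G = d \<and>
       induced_biclique_free 2 (t + 1) G \<longrightarrow>
       real (clique_number G) \<ge>
         root t ((real d)^2 / (2 * real n * real t) * (1 - \<epsilon> n)) - real t)"
proof (intro exI[of _ "\<lambda>_. 0"] conjI allI impI; (elim conjE)?)
  fix G :: "('a, 'b) pre_digraph" and n d
  assume "graph G" and ne: "verts G \<noteq> {}" and n: "card (verts G) = n"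
    and d: "min_degree G = d" and free: "induced_biclique_free 2 (t + 1) G"
  interpret graph G by fact
  have deg: "d \<le> out_degree G v" if "v \<in> verts G" for v
    using that d by (auto simp: min_degree_def)
  have "n > 0" using ne n by (auto simp: card_gt_0_iff)
  let ?w = "real (clique_number G + t)"
  have "(real d)\<^sup>2 \<le> 4 * real n * ?w ^ t"
    using degree_square_le_clique_number_power[OF assms ne free deg] n by simp
  \<comment> \<open>The constant 4 is at most \<open>2 * t\<close> because
    \<open>t \<ge> 2\<close>.\<close>
  also have "\<dots> \<le> 2 * real n * real t * ?w ^ t"
    using assms by (intro mult_right_mono) (auto simp: mult.commute mult_left_mono)
  finally have "(real d)\<^sup>2 / (2 * real n * real t) \<le> ?w ^ t"
    using \<open>n > 0\<close> assms by (simp add: field_simps)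
  then have "root t ((real d)\<^sup>2 / (2 * real n * real t)) \<le> root t (?w ^ t)"
    using assms by (intro real_root_le_mono) auto
  then show "real (clique_number G) \<ge>
      root t ((real d)^2 / (2 * real n * real t) * (1 - 0)) - real t"
    using assms by (simp add: real_root_power_cancel)
qed simp

end
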